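(* Let $Q$, $A$, $B$, $C_Q$, $c(t)$, $c^\perp(t)$ be as in the context, $c_1,c_2\in C_Q$ and $a,b\in\mathbb{R}^2$. Then \begin{equation*} \left(\Delta_0 -\frac{1}{4} \right) \widehat{\Phi}_{a,b}^{c_1,c_2} = \frac{\pi}{2} \left(\theta_{a,b}^{c_2} - \theta_{a,b}^{c_1}\right), \end{equation*} where $\Delta_0=-y^2\left(\frac{\partial^2}{\partial x^2}+\frac{\partial^2}{\partial y^2}\right)$ and, for $c=c(t_0)\in C_Q$ with $c^\perp=c^\perp(t_0)$, \begin{equation*} \theta_{a,b}^c (\tau) = y^{3/2} \sum_{\nu\in a+\mathbb{Z}^2} B(\nu,c) B(\nu,c^\perp) e^{\frac{\pi i}{2} \tau B(\nu,c^\perp)^2 - \frac{\pi i}{2} \overline{\tau} B(\nu,c)^2} e^{2\pi i B(\nu,b)}. \end{equation*}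
   Context: $A$ is a symmetric $2\times 2$ integer matrix such that $Q(\nu)=\frac12\nu^tA\nu$ on $\mathbb{R}^2$ has signature $(1,1)$; $B(\nu,\mu)=\nu^tA\mu$. $C_Q$ is a fixed one of the two components of $\{c\in\mathbb{R}^2:Q(c)=-1\}$. Choose $P\in\mathrm{GL}_2(\mathbb{R})$ with $A=P^t\begin{pmatrix}0&1\\1&0\end{pmatrix}P$ and $P^{-1}\binom{1}{-1}\in C_Q$; set $c(t)=P^{-1}\binom{e^t}{-e^{-t}}$, $c^\perp(t)=P^{-1}\binom{e^t}{e^{-t}}$. For $c_i\in C_Q$, $t_i$ is defined by $c(t_i)=c_i$. For $\tau=x+iy\in\mathbb{H}$, $q=e^{2\pi i\tau}$, \begin{equation*} \widehat{\Phi}^{c_1,c_2}_{a,b}(\tau)=y^{1/2}\sum_{\nu\in a+\mathbb{Z}^2} q^{Q(\nu)}e^{2\pi iB(\nu,b)}\int_{t_1}^{t_2}e^{-\pi yB(\nu,c(t))^2}\,dt. \end{equation*} *)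

theory Defs
  imports "HOL-Analysis.Analysis"
begin

definition B_form :: "real^2^2 \<Rightarrow> real^2 \<Rightarrow> real^2 \<Rightarrow> real" where
  "B_form A \<nu> \<mu> = \<nu> \<bullet> (A *v \<mu>)"

definition Q_form :: "real^2^2 \<Rightarrow> real^2 \<Rightarrow> real" where
  "Q_form A \<nu> = (1/2) * (\<nu> \<bullet> (A *v \<nu>))"

text \<open>Signature in the sense of Sylvester: some invertible linear change of variables turns
  \<open>q\<close> into a diagonal form with \<open>r\<close> positive and \<open>s\<close> negative coefficients.\<close>

definition has_signature :: "(real^'n \<Rightarrow> real) \<Rightarrow> nat \<Rightarrow> nat \<Rightarrow> bool" where
  "has_signature q r s \<longleftrightarrow>
     (\<exists>(S :: real^'n^'n) (d :: 'n \<Rightarrow> real). invertible S \<and>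
        (\<forall>x. q (S *v x) = (\<Sum>i\<in>UNIV. d i * (x $ i)\<^sup>2)) \<and>
        card {i. d i > 0} = r \<and> card {i. d i < 0} = s)"

definition hyp_matrix :: "real^2^2" where
  "hyp_matrix = vector [vector [0, 1], vector [1, 0]]"

definition c_curve :: "real^2^2 \<Rightarrow> real \<Rightarrow> real^2" where
  "c_curve P t = matrix_inv P *v vector [exp t, - exp (- t)]"

definition c_perp :: "real^2^2 \<Rightarrow> real \<Rightarrow> real^2" where
  "c_perp P t = matrix_inv P *v vector [exp t, exp (- t)]"

definition t_param :: "real^2^2 \<Rightarrow> real^2 \<Rightarrow> real" where
  "t_param P c = (THE t. c_curve P t = c)"

definition shifted_lattice :: "real^2 \<Rightarrow> (real^2) set" where
  "shifted_lattice a = {a + n | n. \<forall>i. n $ i \<in> \<int>}"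

text \<open>The power \<open>q\<^bsup>Q(\<nu>)\<^esup>\<close> has a real exponent and means \<open>exp (2 \<pi> i \<tau> Q(\<nu>))\<close>.
  The integral is oriented, so \<open>t_param P c1 > t_param P c2\<close> is allowed.\<close>

definition Phi_term ::
  "real^2^2 \<Rightarrow> real^2^2 \<Rightarrow> real^2 \<Rightarrow> real^2 \<Rightarrow> real^2 \<Rightarrow> complex \<Rightarrow> real^2 \<Rightarrow> complex" where
  "Phi_term A P c1 c2 b \<tau> \<nu> =
     exp (2 * pi * \<i> * \<tau> * of_real (Q_form A \<nu>)) *
     exp (2 * pi * \<i> * of_real (B_form A \<nu> b)) *
     of_real (LBINT t=t_param P c1..t_param P c2.
                exp (- pi * Im \<tau> * (B_form A \<nu> (c_curve P t))\<^sup>2))"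

definition Phi_hat ::
  "real^2^2 \<Rightarrow> real^2^2 \<Rightarrow> real^2 \<Rightarrow> real^2 \<Rightarrow> real^2 \<Rightarrow> real^2 \<Rightarrow> complex \<Rightarrow> complex" where
  "Phi_hat A P c1 c2 a b \<tau> =
     of_real (Im \<tau> powr (1/2)) * (\<Sum>\<^sub>\<infinity>\<nu>\<in>shifted_lattice a. Phi_term A P c1 c2 b \<tau> \<nu>)"

definition theta_term ::
  "real^2^2 \<Rightarrow> real^2^2 \<Rightarrow> real^2 \<Rightarrow> real^2 \<Rightarrow> complex \<Rightarrow> real^2 \<Rightarrow> complex" where
  "theta_term A P c b \<tau> \<nu> =
     (let \<beta> = B_form A \<nu> c; \<beta>' = B_form A \<nu> (c_perp P (t_param P c)) in
      of_real (\<beta> * \<beta>') *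
      exp (pi * \<i> / 2 * \<tau> * of_real (\<beta>'\<^sup>2) - pi * \<i> / 2 * cnj \<tau> * of_real (\<beta>\<^sup>2)) *
      exp (2 * pi * \<i> * of_real (B_form A \<nu> b)))"

definition theta ::
  "real^2^2 \<Rightarrow> real^2^2 \<Rightarrow> real^2 \<Rightarrow> real^2 \<Rightarrow> real^2 \<Rightarrow> complex \<Rightarrow> complex" where
  "theta A P c a b \<tau> =
     of_real (Im \<tau> powr (3/2)) * (\<Sum>\<^sub>\<infinity>\<nu>\<in>shifted_lattice a. theta_term A P c b \<tau> \<nu>)"

definition partial_x :: "(complex \<Rightarrow> complex) \<Rightarrow> complex \<Rightarrow> complex" where
  "partial_x f \<tau> = vector_derivative (\<lambda>x. f (Complex x (Im \<tau>))) (at (Re \<tau>))"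

definition partial_y :: "(complex \<Rightarrow> complex) \<Rightarrow> complex \<Rightarrow> complex" where
  "partial_y f \<tau> = vector_derivative (\<lambda>y. f (Complex (Re \<tau>) y)) (at (Im \<tau>))"

definition Delta0 :: "(complex \<Rightarrow> complex) \<Rightarrow> complex \<Rightarrow> complex" where
  "Delta0 f \<tau> =
     - of_real ((Im \<tau>)\<^sup>2) * (partial_x (partial_x f) \<tau> + partial_y (partial_y f) \<tau>)"

text \<open>Existence of the four derivatives in \<^const>\<open>Delta0\<close>, each of which is otherwise an
  unspecified value of \<^const>\<open>vector_derivative\<close>.\<close>

definition Delta0_defined :: "(complex \<Rightarrow> complex) \<Rightarrow> complex \<Rightarrow> bool" where
  "Delta0_defined f \<tau> \<longleftrightarrow>
     (\<lambda>x. f (Complex x (Im \<tau>))) differentiable at (Re \<tau>) \<and>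
     (\<lambda>y. f (Complex (Re \<tau>) y)) differentiable at (Im \<tau>) \<and>
     (\<lambda>x. partial_x f (Complex x (Im \<tau>))) differentiable at (Re \<tau>) \<and>
     (\<lambda>y. partial_y f (Complex (Re \<tau>) y)) differentiable at (Im \<tau>)"

end

theory Submission
  imports Defs
begin

text \<open>In the coordinates \<open>(u, v) = P *v \<nu>\<close> one has \<open>Q(\<nu>) = u v\<close>, \<open>B(\<nu>, c(t)) = v e\<^sup>t - u e\<^bsup>-t\<^esup>\<close> and
  \<open>B(\<nu>, c\<^sup>\<bottom>(t)) = v e\<^sup>t + u e\<^bsup>-t\<^esup>\<close>. With \<open>s(t) = v\<^sup>2 e\<^bsup>2t\<^esup> + u\<^sup>2 e\<^bsup>-2t\<^esup>\<close> (the positive definite majorant of \<open>2 Q\<close>),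
  the \<open>\<nu>\<close>-th term of the series is \<open>e\<^bsup>2\<pi>ixuv\<^esup> \<integral> e\<^bsup>-\<pi>ys(t)\<^esup> dt\<close> times a phase, while the \<open>\<nu>\<close>-th theta term is
  \<open>s'(t) / 2 \<cdot> e\<^bsup>2\<pi>ixuv\<^esup> e\<^bsup>-\<pi>ys(t)\<^esup>\<close>. Since \<open>s\<^sup>2 - 4u\<^sup>2v\<^sup>2 = (s'/2)\<^sup>2\<close> and \<open>s'' = 4s\<close>, applying \<open>\<Delta>\<^sub>0 - 1/4\<close> to
  \<open>y\<^bsup>1/2\<^esup> e\<^bsup>2\<pi>ixuv\<^esup> e\<^bsup>-\<pi>ys(t)\<^esup>\<close> gives \<open>\<pi>/4 y\<^bsup>3/2\<^esup> d/dt (s' e\<^bsup>-\<pi>ys\<^esup>) e\<^bsup>2\<pi>ixuv\<^esup>\<close>, and the integral over \<open>t\<close> collapses to its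
  boundary terms. On bounded \<open>t\<close>-intervals \<open>s(t)\<close> is comparable to \<open>|\<nu>|\<^sup>2\<close>, so Gaussian domination
  justifies differentiating term by term.\<close>

subsection \<open>Termwise differentiation\<close>

text \<open>Tannery's theorem for unordered sums: where \<open>M\<close> dominates, the finite
  partial sums converge uniformly by the Weierstrass test, so the two limits may be
  exchanged.\<close>

lemma tendsto_infsum_dominated:
  fixes f :: "'i \<Rightarrow> 'a \<Rightarrow> 'b :: banach" and M :: "'i \<Rightarrow> real"
  assumes lim: "\<And>i. i \<in> I \<Longrightarrow> (f i \<longlongrightarrow> l i) F"
    and ev: "\<forall>\<^sub>F x in F. \<forall>i\<in>I. norm (f i x) \<le> M i"
    and M: "M summable_on I" and l: "l summable_on I"
  shows "((\<lambda>x. \<Sum>\<^sub>\<infinity>i\<in>I. f i x) \<longlongrightarrow> (\<Sum>\<^sub>\<infinity>i\<in>I. l i)) F"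
proof (rule swap_uniform_limit')
  show "\<forall>\<^sub>F X in finite_subsets_at_top I. ((\<lambda>x. \<Sum>i\<in>X. f i x) \<longlongrightarrow> (\<Sum>i\<in>X. l i)) F"
    by (rule eventually_finite_subsets_at_top_weakI) (use lim in \<open>auto intro!: tendsto_sum\<close>)
  show "((\<lambda>X. \<Sum>i\<in>X. l i) \<longlongrightarrow> (\<Sum>\<^sub>\<infinity>i\<in>I. l i)) (finite_subsets_at_top I)"
    using infsum_tendsto[OF l] .
  show "uniform_limit {x. \<forall>i\<in>I. norm (f i x) \<le> M i} (\<lambda>X x. \<Sum>i\<in>X. f i x)
          (\<lambda>x. \<Sum>\<^sub>\<infinity>i\<in>I. f i x) (finite_subsets_at_top I)"
    by (rule Weierstrass_m_test_general[OF _ M]) auto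
qed (use ev in auto)

lemma has_sum_diff:
  fixes f g :: "'i \<Rightarrow> 'b :: topological_ab_group_add"
  assumes "(f has_sum a) I" "(g has_sum b) I"
  shows "((\<lambda>i. f i - g i) has_sum (a - b)) I"
  using tendsto_diff[OF assms[unfolded has_sum_def]] unfolding has_sum_def sum_subtractf[abs_def] .

text \<open>The mean value inequality on the convex set \<open>S\<close> bounds each normalised
  first-order remainder by \<open>2 * M i\<close>; dominated convergence then sends the sum of the
  remainders to 0.\<close>

lemma has_vector_derivative_infsum:
  fixes f f' :: "'i \<Rightarrow> real \<Rightarrow> 'b :: banach" and M :: "'i \<Rightarrow> real"
  assumes S: "open S" "convex S" "x \<in> S"
    and deriv: "\<And>i y. i \<in> I \<Longrightarrow> y \<in> S \<Longrightarrow> (f i has_vector_derivative f' i y) (at y)"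
    and bound: "\<And>i y. i \<in> I \<Longrightarrow> y \<in> S \<Longrightarrow> norm (f' i y) \<le> M i"
    and M: "M summable_on I"
    and summable: "\<And>y. y \<in> S \<Longrightarrow> (\<lambda>i. f i y) summable_on I"
  shows "((\<lambda>y. \<Sum>\<^sub>\<infinity>i\<in>I. f i y) has_vector_derivative (\<Sum>\<^sub>\<infinity>i\<in>I. f' i x)) (at x)"
proof -
  \<comment> \<open>At \<open>y = x\<close> division by zero makes the remainder 0, so that case
    only needs \<open>0 \<le> M i\<close>.\<close>
  define R where "R i y = (1 / norm (y - x)) *\<^sub>R (f i y - (f i x + (y - x) *\<^sub>R f' i x))" for i y
  have f'_summable: "(\<lambda>i. f' i x) summable_on I"
    by (rule abs_summable_summable, rule Infinite_Sum.abs_summable_on_comparison_test'[OF M])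
       (use bound S in auto)
  have "(R i \<longlongrightarrow> 0) (at x)" if "i \<in> I" for i
    using deriv[OF that \<open>x \<in> S\<close>]
    unfolding has_vector_derivative_def has_derivative_within R_def by simp
  moreover have "norm (R i y) \<le> 2 * M i" if "i \<in> I" "y \<in> S" for i y
  proof (cases "y = x")
    case True
    have "0 \<le> M i" using bound[OF that] norm_ge_zero order_trans by blast
    then show ?thesis using True by (simp add: R_def)
  next
    case False
    have "norm (f i y - f i x) \<le> M i * norm (y - x)"
    proof (rule differentiable_bound[OF \<open>convex S\<close>])
      show "(f i has_derivative (\<lambda>h. h *\<^sub>R f' i z)) (at z within S)" if "z \<in> S" for z
        using deriv[OF \<open>i \<in> I\<close> that] has_derivative_at_withinI
        unfolding has_vector_derivative_def by blast
      show "onorm (\<lambda>h. h *\<^sub>R f' i z) \<le> M i" if "z \<in> S" for z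
        using bound[OF \<open>i \<in> I\<close> that] by (simp add: onorm_scaleR_left onorm_id)
    qed (use S that in auto)
    moreover have "norm ((y - x) *\<^sub>R f' i x) \<le> M i * norm (y - x)"
      using mult_right_mono[OF bound[OF \<open>i \<in> I\<close> \<open>x \<in> S\<close>], of "norm (y - x)"]
      by (simp add: mult.commute)
    ultimately have "norm (f i y - f i x - (y - x) *\<^sub>R f' i x) \<le> 2 * M i * norm (y - x)"
      using norm_triangle_ineq4[of "f i y - f i x" "(y - x) *\<^sub>R f' i x"] by linarith
    then show ?thesis
      using False by (simp add: R_def diff_diff_eq divide_le_eq)
  qed
  then have "\<forall>\<^sub>F y in at x. \<forall>i\<in>I. norm (R i y) \<le> 2 * M i"
    by (intro eventually_mono[OF eventually_at_in_open'[OF \<open>open S\<close> \<open>x \<in> S\<close>]]) auto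
  moreover have "(\<lambda>i. 2 * M i) summable_on I"
    using M by (rule summable_on_cmult_right)
  ultimately have "((\<lambda>y. \<Sum>\<^sub>\<infinity>i\<in>I. R i y) \<longlongrightarrow> (\<Sum>\<^sub>\<infinity>i\<in>I. 0)) (at x)"
    by (intro tendsto_infsum_dominated) auto
  moreover have "\<forall>\<^sub>F y in at x. (\<Sum>\<^sub>\<infinity>i\<in>I. R i y) = (1 / norm (y - x)) *\<^sub>R ((\<Sum>\<^sub>\<infinity>i\<in>I. f i y)
      - ((\<Sum>\<^sub>\<infinity>i\<in>I. f i x) + (y - x) *\<^sub>R (\<Sum>\<^sub>\<infinity>i\<in>I. f' i x)))"
    using eventually_at_in_open'[OF \<open>open S\<close> \<open>x \<in> S\<close>]
  proof (rule eventually_mono)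
    fix y assume "y \<in> S"
    note sums = has_sum_infsum[OF summable[OF \<open>y \<in> S\<close>]] has_sum_infsum[OF summable[OF \<open>x \<in> S\<close>]]
      has_sum_infsum[OF f'_summable]
    show "(\<Sum>\<^sub>\<infinity>i\<in>I. R i y) = (1 / norm (y - x)) *\<^sub>R ((\<Sum>\<^sub>\<infinity>i\<in>I. f i y)
      - ((\<Sum>\<^sub>\<infinity>i\<in>I. f i x) + (y - x) *\<^sub>R (\<Sum>\<^sub>\<infinity>i\<in>I. f' i x)))"
      unfolding R_def
      by (intro infsumI has_sum_scaleR has_sum_diff has_sum_add sums)
  qed
  ultimately show ?thesis
    unfolding has_vector_derivative_def has_derivative_within
    by (auto simp: bounded_linear_scaleR_left elim: Lim_transform_eventually)
qed

subsection \<open>Gaussian sums over shifted lattices\<close>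

text \<open>Half of the decay absorbs the power: the single term
  \<open>(c / 2 * x) ^ n / fact n\<close> of the exponential series is at most
  \<open>exp (c / 2 * x)\<close>.\<close>

lemma power_times_exp_bounded:
  fixes c :: real
  assumes "c > 0"
  obtains K where "K \<ge> 0" "\<And>x. x \<ge> 0 \<Longrightarrow> x ^ n * exp (- (c * x)) \<le> K * exp (- (c / 2 * x))"
proof
  show "fact n * (2 / c) ^ n \<ge> 0" using assms by simp
  fix x :: real assume "x \<ge> 0"
  have "(c / 2 * x) ^ n / fact n \<le> exp (c / 2 * x)"
  proof -
    have "(\<Sum>k\<in>{n}. (c / 2 * x) ^ k /\<^sub>R fact k) \<le> exp (c / 2 * x)"
      unfolding exp_def
      by (rule sum_le_suminf[OF summable_exp_generic]) (use assms \<open>x \<ge> 0\<close> in auto)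
    then show ?thesis by (simp add: field_simps)
  qed
  then have "x ^ n \<le> fact n * (2 / c) ^ n * exp (c / 2 * x)"
    using assms by (simp add: power_mult_distrib power_divide field_simps)
  then have "x ^ n * exp (- (c * x)) \<le> fact n * (2 / c) ^ n * exp (c / 2 * x) * exp (- (c * x))"
    by (intro mult_right_mono) auto
  also have "\<dots> = fact n * (2 / c) ^ n * exp (- (c / 2 * x))"
    by (simp add: mult.assoc flip: exp_add)
  finally show "x ^ n * exp (- (c * x)) \<le> fact n * (2 / c) ^ n * exp (- (c / 2 * x))" .
qed

text \<open>Comparison with a geometric series in |n|; its ratio \<open>exp (- c / 2)\<close> is
  dictated by (a + n)^2 >= |n|/2 - a^2.\<close>

lemma summable_on_shifted_int_gaussian:
  fixes a c :: real
  assumes "c > 0"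
  shows "(\<lambda>n::int. exp (- c * (a + of_int n)\<^sup>2)) summable_on UNIV"
proof -
  define r where "r = exp (- c / 2)"
  have r: "0 < r" "r < 1" using assms by (auto simp: r_def)
  have nat_summable: "(\<lambda>n::nat. r ^ n) summable_on UNIV"
    by (rule norm_summable_imp_summable_on) (use r in \<open>simp add: norm_power summable_geometric\<close>)
  have "(\<lambda>n::int. r ^ nat \<bar>n\<bar>) summable_on (range int)"
    using nat_summable by (subst summable_on_reindex) (auto simp: o_def inj_on_def)
  moreover have "(\<lambda>n::int. r ^ nat \<bar>n\<bar>) summable_on (range (\<lambda>n. - int n))"
    using nat_summable by (subst summable_on_reindex) (auto simp: o_def inj_on_def)
  ultimately have "(\<lambda>n::int. r ^ nat \<bar>n\<bar>) summable_on (range int \<union> range (\<lambda>n. - int n))"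
    by (rule summable_on_union)
  moreover have "range int \<union> range (\<lambda>n. - int n) = UNIV"
  proof -
    have "n \<in> range int \<union> range (\<lambda>n. - int n)" for n :: int
      by (cases n rule: int_cases2) auto
    then show ?thesis by blast
  qed
  ultimately have "(\<lambda>n::int. r ^ nat \<bar>n\<bar>) summable_on UNIV" by simp
  then have "(\<lambda>n::int. exp (c * a\<^sup>2) * r ^ nat \<bar>n\<bar>) summable_on UNIV"
    by (rule summable_on_cmult_right)
  then show ?thesis
  proof (rule summable_on_comparison_test)
    fix n :: int
    have "\<bar>n\<bar> \<le> n\<^sup>2" 
      using self_le_power[of "\<bar>n\<bar>" 2] by (cases "n = 0") auto
    then have "real_of_int \<bar>n\<bar> \<le> (of_int n)\<^sup>2"
      by (metis of_int_le_iff of_int_power)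
    \<comment> \<open>Twice the difference of the two sides is the square of 2a + n.\<close>
    moreover have "(a + of_int n)\<^sup>2 \<ge> (of_int n)\<^sup>2 / 2 - a\<^sup>2"
      using zero_le_power2[of "2 * a + of_int n"] by (simp add: power2_eq_square algebra_simps)
    ultimately have "(a + of_int n)\<^sup>2 \<ge> of_int \<bar>n\<bar> / 2 - a\<^sup>2" by linarith
    then have "c * (a + of_int n)\<^sup>2 \<ge> c * (of_int \<bar>n\<bar> / 2 - a\<^sup>2)"
      using assms by (intro mult_left_mono) auto
    then have "exp (- c * (a + of_int n)\<^sup>2) \<le> exp (c * a\<^sup>2 + real (nat \<bar>n\<bar>) * (- c / 2))"
      by (simp add: algebra_simps)
    also have "\<dots> = exp (c * a\<^sup>2) * r ^ nat \<bar>n\<bar>"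
      unfolding r_def exp_add exp_of_nat_mult ..
    finally show "exp (- c * (a + of_int n)\<^sup>2) \<le> exp (c * a\<^sup>2) * r ^ nat \<bar>n\<bar>" .
  qed auto
qed

lemma bij_betw_shifted_lattice:
  "bij_betw (\<lambda>(m, n). a + vector [of_int m, of_int n]) UNIV (shifted_lattice a)"
  unfolding bij_betw_def
proof
  show "inj (\<lambda>(m, n). a + vector [of_int m, of_int n] :: real^2)"
    by (auto simp: inj_def vec_eq_iff forall_2)
  show "range (\<lambda>(m, n). a + vector [of_int m, of_int n]) = shifted_lattice a"
  proof (intro equalityI subsetI)
    fix \<nu> assume "\<nu> \<in> shifted_lattice a"
    then obtain n where n: "\<nu> = a + n" "n $ 1 \<in> \<int>" "n $ 2 \<in> \<int>"
      by (auto simp: shifted_lattice_def)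
    then obtain k l where "n $ 1 = of_int k" "n $ 2 = of_int l" by (auto elim!: Ints_cases)
    then have "\<nu> = (\<lambda>(m, n). a + vector [of_int m, of_int n]) (k, l)"
      by (simp add: n vec_eq_iff forall_2)
    then show "\<nu> \<in> range (\<lambda>(m, n). a + vector [of_int m, of_int n])" by blast
  qed (auto simp: shifted_lattice_def forall_2)
qed

text \<open>The Gaussian of the Euclidean norm factors over the two coordinates, which reduces the
  claim to iterated one-dimensional sums.\<close>

lemma summable_on_shifted_lattice_gaussian:
  assumes "c > 0"
  shows "(\<lambda>\<nu>. exp (- c * (norm \<nu>)\<^sup>2)) summable_on shifted_lattice a"
proof -
  let ?g = "\<lambda>i n::int. exp (- c * (a $ i + of_int n)\<^sup>2)"
  have "(\<lambda>(m, n). ?g 1 m * ?g 2 n) summable_on (UNIV \<times> UNIV)"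
  proof (rule summable_on_SigmaI)
    show "((\<lambda>n. case (m, n) of (m, n) \<Rightarrow> ?g 1 m * ?g 2 n) has_sum ?g 1 m * (\<Sum>\<^sub>\<infinity>n. ?g 2 n)) UNIV" for m
      using has_sum_cmult_right[OF has_sum_infsum[OF summable_on_shifted_int_gaussian[OF assms, of "a $ 2"]]]
      by simp
    show "(\<lambda>m. ?g 1 m * (\<Sum>\<^sub>\<infinity>n. ?g 2 n)) summable_on UNIV"
      by (intro summable_on_cmult_left summable_on_shifted_int_gaussian assms)
  qed auto
  moreover have "(norm \<nu>)\<^sup>2 = (\<nu> $ 1)\<^sup>2 + (\<nu> $ 2)\<^sup>2" for \<nu> :: "real^2"
    by (simp add: norm_vec_def L2_set_def sum_2)
  ultimately show ?thesis
    by (subst summable_on_reindex_bij_betw[OF bij_betw_shifted_lattice, symmetric])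
       (simp add: case_prod_unfold distrib_left flip: exp_add)
qed

lemma matrix_inv_mult:
  fixes P :: "'a :: semiring_1 ^ 'n ^ 'n"
  assumes "invertible P"
  shows "matrix_inv P ** P = mat 1" "P ** matrix_inv P = mat 1"
  using someI_ex[OF assms[unfolded invertible_def]] unfolding matrix_inv_def by auto

text \<open>A bound \<open>B\<close> for the inverse of \<open>P\<close> bounds \<open>P\<close>
  from below, so the sum is dominated by a round Gaussian with constant
  \<open>c / B\<^sup>2\<close>.\<close>

lemma summable_on_shifted_lattice_gaussian_invertible:
  fixes P :: "real^2^2"
  assumes "invertible P" "c > 0"
  shows "(\<lambda>\<nu>. exp (- (c * (((P *v \<nu>) $ 1)\<^sup>2 + ((P *v \<nu>) $ 2)\<^sup>2)))) summable_on shifted_lattice a"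
proof -
  obtain B where B: "B > 0" "\<And>x. norm (matrix_inv P *v x) \<le> norm x * B"
    using bounded_linear.pos_bounded[OF matrix_vector_mul_bounded_linear[of "matrix_inv P"]] by blast
  have "(norm \<nu>)\<^sup>2 / B\<^sup>2 \<le> ((P *v \<nu>) $ 1)\<^sup>2 + ((P *v \<nu>) $ 2)\<^sup>2" for \<nu>
  proof -
    have "matrix_inv P *v (P *v \<nu>) = \<nu>"
      using assms(1) by (simp add: matrix_vector_mul_assoc matrix_inv_mult)
    then have "norm \<nu> \<le> norm (P *v \<nu>) * B" using B(2)[of "P *v \<nu>"] by simp
    then have "(norm \<nu>)\<^sup>2 \<le> (norm (P *v \<nu>))\<^sup>2 * B\<^sup>2"
      by (metis norm_ge_zero power_mono power_mult_distrib)
    then show ?thesis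
      using B(1) by (simp add: norm_vec_def L2_set_def sum_2 field_simps)
  qed
  note * = this
  have "(\<lambda>\<nu>. exp (- (c / B\<^sup>2) * (norm \<nu>)\<^sup>2)) summable_on shifted_lattice a"
    by (rule summable_on_shifted_lattice_gaussian) (use assms B in auto)
  then show ?thesis
  proof (rule summable_on_comparison_test)
    fix \<nu>
    show "exp (- (c * (((P *v \<nu>) $ 1)\<^sup>2 + ((P *v \<nu>) $ 2)\<^sup>2))) \<le> exp (- (c / B\<^sup>2) * (norm \<nu>)\<^sup>2)"
      using mult_left_mono[OF *, of c \<nu>] assms by simp
  qed auto
qed

subsection \<open>The integral over one lattice vector\<close>

text \<open>With (u, v) the coordinates of \<open>P *v \<nu>\<close>, this is half the sum of the
  squares of B(nu, c(t)) and B(nu, c_perp(t)); \<open>flux\<close> is their product.\<close>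

definition energy :: "real \<Rightarrow> real \<Rightarrow> real \<Rightarrow> real" where
  "energy u v t = v\<^sup>2 * exp (2 * t) + u\<^sup>2 * exp (- 2 * t)"

definition flux :: "real \<Rightarrow> real \<Rightarrow> real \<Rightarrow> real" where
  "flux u v t = v\<^sup>2 * exp (2 * t) - u\<^sup>2 * exp (- 2 * t)"

text \<open>(X + Y)^2 = (X - Y)^2 + 4XY for the two summands of \<open>energy\<close>, whose product
  does not depend on t.\<close>

lemma energy_squared: "(energy u v t)\<^sup>2 = (flux u v t)\<^sup>2 + 4 * u\<^sup>2 * v\<^sup>2"
proof -
  have "exp (2 * t) * exp (- 2 * t) = 1" by (simp flip: exp_add)
  then show ?thesis unfolding energy_def flux_def by algebra
qed

lemma has_real_derivative_energy: "(energy u v has_real_derivative 2 * flux u v t) (at t within S)"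
  unfolding energy_def flux_def by (auto intro!: derivative_eq_intros simp: algebra_simps)

lemma has_real_derivative_flux: "(flux u v has_real_derivative 2 * energy u v t) (at t within S)"
  unfolding energy_def flux_def by (auto intro!: derivative_eq_intros simp: algebra_simps)

lemma energy_nonneg: "0 \<le> energy u v t"
  by (simp add: energy_def)

lemma energy_bounds:
  assumes "\<bar>t\<bar> \<le> c"
  shows "energy u v t \<le> exp (2 * c) * (u\<^sup>2 + v\<^sup>2)" "exp (- (2 * c)) * (u\<^sup>2 + v\<^sup>2) \<le> energy u v t"
proof -
  have "v\<^sup>2 * exp (2 * t) \<le> v\<^sup>2 * exp (2 * c)" "u\<^sup>2 * exp (- 2 * t) \<le> u\<^sup>2 * exp (2 * c)"
    "v\<^sup>2 * exp (- (2 * c)) \<le> v\<^sup>2 * exp (2 * t)" "u\<^sup>2 * exp (- (2 * c)) \<le> u\<^sup>2 * exp (- 2 * t)"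
    using assms by (auto intro!: mult_left_mono)
  then show "energy u v t \<le> exp (2 * c) * (u\<^sup>2 + v\<^sup>2)" "exp (- (2 * c)) * (u\<^sup>2 + v\<^sup>2) \<le> energy u v t"
    by (auto simp: energy_def algebra_simps)
qed

lemma abs_flux_le_energy: "\<bar>flux u v t\<bar> \<le> energy u v t"
proof -
  have "0 \<le> v\<^sup>2 * exp (2 * t)" "0 \<le> u\<^sup>2 * exp (- 2 * t)" by auto
  then show ?thesis unfolding energy_def flux_def by linarith
qed

lemma continuous_on_energy [continuous_intros]:
  "continuous_on S f \<Longrightarrow> continuous_on S (\<lambda>x. energy u v (f x))"
  unfolding energy_def by (intro continuous_intros)

text \<open>Passes to a signed integral over a genuine interval, where the Leibniz rule and the norm
  bound apply whichever endpoint is larger.\<close>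

lemma interval_integral_eq_oriented_integral:
  fixes f :: "real \<Rightarrow> real" and p r :: real
  assumes "continuous_on UNIV f"
  shows "(LBINT t=p..r. f t) = (if p \<le> r then 1 else - 1) * integral {min p r..max p r} f"
proof -
  have f: "set_integrable lborel {p'..r'} f" for p' r'
    by (rule borel_integrable_atLeastAtMost') (use assms continuous_on_subset in blast)
  show ?thesis
  proof (cases "p \<le> r")
    case True
    then show ?thesis using interval_integral_eq_integral[OF _ f] by simp
  next
    case False
    then show ?thesis
      using interval_integral_eq_integral[OF _ f, of r p] interval_integral_endpoints_reverse[of p r f]
      by simp
  qed
qed

text \<open>The k-th y-derivative of the case k = 0, written out so that differentiating in y merely
  raises k.\<close>

definition energy_integral :: "nat \<Rightarrow> real \<Rightarrow> real \<Rightarrow> real \<Rightarrow> real \<Rightarrow> real \<Rightarrow> real" where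
  "energy_integral k p r u v y =
     (LBINT t=p..r. (- pi * energy u v t) ^ k * exp (- pi * y * energy u v t))"

lemma has_vector_derivative_energy_integral:
  "(energy_integral k p r u v has_vector_derivative energy_integral (Suc k) p r u v y) (at y)"
proof -
  have eq: "energy_integral k p r u v = (\<lambda>y. (if p \<le> r then 1 else - 1) *
      integral (cbox (min p r) (max p r)) (\<lambda>t. (- pi * energy u v t) ^ k * exp (- pi * y * energy u v t)))" for k
    unfolding energy_integral_def cbox_interval
    by (intro ext interval_integral_eq_oriented_integral continuous_intros)
  have "((\<lambda>y. integral (cbox (min p r) (max p r))
            (\<lambda>t. (- pi * energy u v t) ^ k * exp (- pi * y * energy u v t)))
          has_vector_derivative integral (cbox (min p r) (max p r))
            (\<lambda>t. (- pi * energy u v t) ^ Suc k * exp (- pi * y * energy u v t))) (at y within UNIV)"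
  proof (rule leibniz_rule_vector_derivative)
    show "((\<lambda>y. (- pi * energy u v t) ^ k * exp (- pi * y * energy u v t)) has_vector_derivative
        (- pi * energy u v t) ^ Suc k * exp (- pi * y * energy u v t)) (at y within UNIV)" for y t
      unfolding has_real_derivative_iff_has_vector_derivative[symmetric]
      by (auto intro!: derivative_eq_intros)
    show "(\<lambda>t. (- pi * energy u v t) ^ k * exp (- pi * y * energy u v t))
        integrable_on cbox (min p r) (max p r)" for y
      by (intro integrable_continuous continuous_intros)
    show "continuous_on (UNIV \<times> cbox (min p r) (max p r))
        (\<lambda>(y, t). (- pi * energy u v t) ^ Suc k * exp (- pi * y * energy u v t))"
      unfolding case_prod_unfold by (intro continuous_intros)
  qed auto
  then show ?thesis
    unfolding eq by (rule has_vector_derivative_mult_right)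
qed

text \<open>The bound is uniform in \<open>y \<ge> y0\<close>, as termwise differentiation requires;
  \<open>2 * c\<close> bounds the length of the t-interval.\<close>

lemma abs_energy_integral_le:
  assumes "0 < y0" "y0 \<le> y" "\<bar>p\<bar> \<le> c" "\<bar>r\<bar> \<le> c"
  shows "\<bar>energy_integral k p r u v y\<bar> \<le>
    (pi * exp (2 * c) * (u\<^sup>2 + v\<^sup>2)) ^ k * exp (- (pi * y0 * exp (- (2 * c)) * (u\<^sup>2 + v\<^sup>2))) * (2 * c)"
    (is "_ \<le> ?B * _")
proof -
  let ?f = "\<lambda>t. (- pi * energy u v t) ^ k * exp (- pi * y * energy u v t)"
  have "\<bar>energy_integral k p r u v y\<bar> = \<bar>integral {min p r..max p r} ?f\<bar>"
    unfolding energy_integral_def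
    by (subst interval_integral_eq_oriented_integral) (auto intro!: continuous_intros)
  also have "\<dots> \<le> ?B * (max p r - min p r)"
    unfolding real_norm_def[symmetric]
  proof (rule integral_bound)
    fix t assume "t \<in> {min p r..max p r}"
    then have t: "\<bar>t\<bar> \<le> c" using assms by auto
    have "y0 * (exp (- (2 * c)) * (u\<^sup>2 + v\<^sup>2)) \<le> y * energy u v t"
      using assms by (intro mult_mono energy_bounds t) auto
    moreover have "(pi * energy u v t) ^ k \<le> (pi * exp (2 * c) * (u\<^sup>2 + v\<^sup>2)) ^ k"
      using energy_bounds(1)[OF t, of u v] by (intro power_mono) (auto simp: energy_nonneg mult.assoc)
    ultimately show "norm (?f t) \<le> ?B"
      by (auto simp: abs_mult power_abs energy_nonneg mult.assoc intro!: mult_mono)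
  qed (auto intro!: continuous_intros)
  also have "\<dots> \<le> ?B * (2 * c)"
    using assms by (intro mult_left_mono) auto
  finally show ?thesis .
qed

text \<open>The integrand is the exact derivative of \<open>pi / 2 * flux * exp (- pi * y * energy)\<close>, because
  \<open>energy' = 2 * flux\<close> and \<open>flux' = 2 * energy\<close>.\<close>

lemma energy_integral_identity:
  "4 * pi\<^sup>2 * u\<^sup>2 * v\<^sup>2 * y * energy_integral 0 p r u v y - energy_integral 1 p r u v y
     - y * energy_integral 2 p r u v y =
   pi / 2 * (flux u v r * exp (- pi * y * energy u v r) - flux u v p * exp (- pi * y * energy u v p))"
proof -
  let ?E = "\<lambda>t. exp (- pi * y * energy u v t)"
  let ?f = "\<lambda>k t. (- pi * energy u v t) ^ k * ?E t"
  let ?F = "\<lambda>t. pi / 2 * (flux u v t * ?E t)"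
  have int: "interval_lebesgue_integrable lborel (ereal p) (ereal r) (?f k)" for k
    by (intro interval_integrable_isCont continuous_on_interior[where S = UNIV] continuous_intros) auto
  have "4 * pi\<^sup>2 * u\<^sup>2 * v\<^sup>2 * y * energy_integral 0 p r u v y - energy_integral 1 p r u v y
     - y * energy_integral 2 p r u v y =
     (LBINT t=p..r. 4 * pi\<^sup>2 * u\<^sup>2 * v\<^sup>2 * y * ?f 0 t - ?f 1 t - y * ?f 2 t)"
    unfolding energy_integral_def
    by (subst interval_lebesgue_integral_diff(2), (intro interval_lebesgue_integral_diff(1) interval_lebesgue_integrable_mult_right int)+,
        subst interval_lebesgue_integral_diff(2), (intro interval_lebesgue_integrable_mult_right int)+,
        simp only: interval_lebesgue_integral_mult_right)
  also have "\<dots> = ?F r - ?F p"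
  proof (rule interval_integral_FTC_finite)
    show "continuous_on {min p r..max p r} (\<lambda>t. 4 * pi\<^sup>2 * u\<^sup>2 * v\<^sup>2 * y * ?f 0 t - ?f 1 t - y * ?f 2 t)"
      by (intro continuous_intros)
    fix t
    have "(?F has_real_derivative
        pi / 2 * (2 * energy u v t * ?E t + flux u v t * (?E t * (- pi * y * (2 * flux u v t)))))
        (at t within {min p r..max p r})"
      by (auto intro!: derivative_eq_intros has_real_derivative_energy has_real_derivative_flux
          simp: field_simps)
    moreover have "pi / 2 * (2 * energy u v t * ?E t + flux u v t * (?E t * (- pi * y * (2 * flux u v t)))) =
        4 * pi\<^sup>2 * u\<^sup>2 * v\<^sup>2 * y * ?f 0 t - ?f 1 t - y * ?f 2 t"
    proof -
      \<comment> \<open>Replacing the squared flux yields the terms for k = 0 and k = 2; the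
        derivative of \<open>flux\<close> itself yields the one for k = 1.\<close>
      have "(flux u v t)\<^sup>2 = (energy u v t)\<^sup>2 - 4 * u\<^sup>2 * v\<^sup>2" by (simp add: energy_squared)
      then show ?thesis by (simp add: field_simps power2_eq_square) algebra
    qed
    ultimately show "(?F has_vector_derivative
        4 * pi\<^sup>2 * u\<^sup>2 * v\<^sup>2 * y * ?f 0 t - ?f 1 t - y * ?f 2 t) (at t within {min p r..max p r})"
      by (simp only: has_real_derivative_iff_has_vector_derivative)
  qed
  finally show ?thesis by (simp only: right_diff_distrib)
qed

subsection \<open>Summation over the lattice\<close>

text \<open>Isolates what the analysis needs of the lattice: the unimodular phase
  \<open>\<omega>\<close> stands for exp(2 pi i B(nu, b)), and p, r for the parameters of c1,
  c2.\<close>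

locale gaussian_family =
  fixes L :: "'i set" and u v :: "'i \<Rightarrow> real" and \<omega> :: "'i \<Rightarrow> complex" and p r :: real
  assumes norm_\<omega>: "i \<in> L \<Longrightarrow> norm (\<omega> i) = 1"
    and summable_gaussian:
      "c > 0 \<Longrightarrow> (\<lambda>i. exp (- (c * ((u i)\<^sup>2 + (v i)\<^sup>2)))) summable_on L"
begin

text \<open>\<open>j\<close> counts x-derivatives and \<open>k\<close> counts y-derivatives;
  \<open>mode 0 0\<close> will be the nu-th term of the series, without the factor y^(1/2).\<close>

definition mode :: "nat \<Rightarrow> nat \<Rightarrow> real \<Rightarrow> real \<Rightarrow> 'i \<Rightarrow> complex" where
  "mode j k x y i = \<omega> i * (2 * pi * \<i> * (u i * v i)) ^ j * exp (2 * pi * \<i> * x * (u i * v i)) *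
     energy_integral k p r (u i) (v i) y"

text \<open>The theta term at parameter t, without the factor y^(3/2).\<close>

definition boundary :: "real \<Rightarrow> real \<Rightarrow> real \<Rightarrow> 'i \<Rightarrow> complex" where
  "boundary t x y i = \<omega> i * exp (2 * pi * \<i> * x * (u i * v i)) *
     (flux (u i) (v i) t * exp (- pi * y * energy (u i) (v i) t))"

definition mode_sum :: "nat \<Rightarrow> nat \<Rightarrow> real \<Rightarrow> real \<Rightarrow> complex" where
  "mode_sum j k x y = (\<Sum>\<^sub>\<infinity>i\<in>L. mode j k x y i)"

lemma summable_on_power_gaussian:
  assumes "c > 0"
  shows "(\<lambda>i. ((u i)\<^sup>2 + (v i)\<^sup>2) ^ n * exp (- (c * ((u i)\<^sup>2 + (v i)\<^sup>2)))) summable_on L"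
proof -
  obtain K where "K \<ge> 0" and
    K: "\<And>x. x \<ge> 0 \<Longrightarrow> x ^ n * exp (- (c * x)) \<le> K * exp (- (c / 2 * x))"
    using power_times_exp_bounded[OF assms] by metis
  have "(\<lambda>i. K * exp (- (c / 2 * ((u i)\<^sup>2 + (v i)\<^sup>2)))) summable_on L"
    using assms by (intro summable_on_cmult_right summable_gaussian) auto
  then show ?thesis
    by (rule summable_on_comparison_test, intro K) auto
qed

text \<open>The exponential in x is unimodular, so one polynomial times a Gaussian serves for all x
  and all \<open>y \<ge> y0\<close>.\<close>

lemma mode_dominated:
  assumes "y0 > 0"
  obtains M where "M summable_on L"
    "\<And>i x y. i \<in> L \<Longrightarrow> y0 \<le> y \<Longrightarrow> norm (mode j k x y i) \<le> M i"
proof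
  define c where "c = max \<bar>p\<bar> \<bar>r\<bar>"
  define K where "K = (2 * pi) ^ j * (pi * exp (2 * c)) ^ k * (2 * c)"
  define N where "N i = (u i)\<^sup>2 + (v i)\<^sup>2" for i
  define M where "M i = K * (N i ^ (j + k) * exp (- (pi * y0 * exp (- (2 * c)) * N i)))" for i
  show "M summable_on L"
    unfolding M_def N_def using assms by (intro summable_on_cmult_right summable_on_power_gaussian) auto
  fix i x y assume i: "i \<in> L" and y: "y0 \<le> y"
  \<comment> \<open>The right-hand side equals 2(N - |uv|).\<close>
  have "0 \<le> (\<bar>u i\<bar> - \<bar>v i\<bar>)\<^sup>2 + (u i)\<^sup>2 + (v i)\<^sup>2" by simp
  then have uv: "\<bar>u i * v i\<bar> \<le> N i"
    unfolding N_def abs_mult power2_diff by (simp add: algebra_simps)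
  have E: "\<bar>energy_integral k p r (u i) (v i) y\<bar> \<le>
      (pi * exp (2 * c) * N i) ^ k * exp (- (pi * y0 * exp (- (2 * c)) * N i)) * (2 * c)"
    unfolding N_def by (rule abs_energy_integral_le) (use assms y in \<open>auto simp: c_def\<close>)
  have "norm (mode j k x y i) = (2 * pi * \<bar>u i * v i\<bar>) ^ j * \<bar>energy_integral k p r (u i) (v i) y\<bar>"
    using norm_\<omega>[OF i] by (simp add: mode_def norm_mult norm_power abs_mult norm_exp_eq_Re)
  also have "\<dots> \<le> (2 * pi * N i) ^ j *
      ((pi * exp (2 * c) * N i) ^ k * exp (- (pi * y0 * exp (- (2 * c)) * N i)) * (2 * c))"
    by (intro mult_mono power_mono E uv) (auto simp: N_def)
  also have "\<dots> = M i"
    by (simp add: M_def K_def power_mult_distrib power_add)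
  finally show "norm (mode j k x y i) \<le> M i" .
qed

lemma summable_on_mode:
  assumes "y > 0"
  shows "mode j k x y summable_on L"
proof -
  obtain M where "M summable_on L" "\<And>i. i \<in> L \<Longrightarrow> norm (mode j k x y i) \<le> M i"
    using mode_dominated[OF assms] by (metis order_refl)
  then show ?thesis
    using abs_summable_summable Infinite_Sum.abs_summable_on_comparison_test' by metis
qed

text \<open>The flux is at most the energy, which is comparable to u^2 + v^2 at the fixed t, so a
  Gaussian with one quadratic factor dominates.\<close>

lemma summable_on_boundary:
  assumes "y > 0"
  shows "boundary t x y summable_on L"
proof (rule abs_summable_summable, rule Infinite_Sum.abs_summable_on_comparison_test')
  let ?N = "\<lambda>i. (u i)\<^sup>2 + (v i)\<^sup>2"
  let ?c = "pi * y * exp (- (2 * \<bar>t\<bar>))"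
  show "(\<lambda>i. exp (2 * \<bar>t\<bar>) * (?N i ^ 1 * exp (- (?c * ?N i)))) summable_on L"
    using assms by (intro summable_on_cmult_right summable_on_power_gaussian) auto
  fix i assume i: "i \<in> L"
  have "pi * y * (exp (- (2 * \<bar>t\<bar>)) * ?N i) \<le> pi * y * energy (u i) (v i) t"
    using assms by (intro mult_left_mono energy_bounds) auto
  then have "\<bar>flux (u i) (v i) t\<bar> * exp (- pi * y * energy (u i) (v i) t) \<le>
      (exp (2 * \<bar>t\<bar>) * ?N i) * exp (- (?c * ?N i))"
    using order_trans[OF abs_flux_le_energy energy_bounds(1)[OF order_refl]]
    by (intro mult_mono) (auto simp: mult.assoc)
  then show "norm (boundary t x y i) \<le> exp (2 * \<bar>t\<bar>) * (?N i ^ 1 * exp (- (?c * ?N i)))"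
    using norm_\<omega>[OF i] by (simp add: boundary_def norm_mult norm_exp_eq_Re mult.assoc)
qed

lemma has_vector_derivative_mode_x:
  "((\<lambda>x. mode j k x y i) has_vector_derivative mode (Suc j) k x y i) (at x)"
proof -
  have "((\<lambda>z. exp (2 * pi * \<i> * z * (u i * v i))) has_field_derivative
      (2 * pi * \<i> * (u i * v i)) * exp (2 * pi * \<i> * of_real x * (u i * v i))) (at (of_real x))"
    by (auto intro!: derivative_eq_intros simp: algebra_simps)
  from has_vector_derivative_real_field[OF this]
  have "((\<lambda>x. \<omega> i * (2 * pi * \<i> * (u i * v i)) ^ j * exp (2 * pi * \<i> * complex_of_real x * (u i * v i)) *
     energy_integral k p r (u i) (v i) y) has_vector_derivative
     \<omega> i * (2 * pi * \<i> * (u i * v i)) ^ j * ((2 * pi * \<i> * (u i * v i)) * exp (2 * pi * \<i> * of_real x * (u i * v i))) *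
     energy_integral k p r (u i) (v i) y) (at x)"
    by (intro has_vector_derivative_mult_left has_vector_derivative_mult_right)
  then show ?thesis by (simp add: mode_def mult_ac)
qed

lemma has_vector_derivative_mode_y:
  "((\<lambda>y. mode j k x y i) has_vector_derivative mode j (Suc k) x y i) (at y)"
  unfolding mode_def
  by (intro has_vector_derivative_mult_right has_vector_derivative_of_real
      has_vector_derivative_energy_integral[folded has_real_derivative_iff_has_vector_derivative])

lemma has_vector_derivative_mode_sum_x:
  assumes "y > 0"
  shows "((\<lambda>x. mode_sum j k x y) has_vector_derivative mode_sum (Suc j) k x y) (at x)"
proof -
  obtain M where "M summable_on L" "\<And>i x. i \<in> L \<Longrightarrow> norm (mode (Suc j) k x y i) \<le> M i"
    using mode_dominated[OF assms] by (metis order_refl)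
  then show ?thesis
    unfolding mode_sum_def
    by (intro has_vector_derivative_infsum[where S = UNIV] has_vector_derivative_mode_x
        summable_on_mode assms) auto
qed

lemma has_vector_derivative_mode_sum_y:
  assumes "y > 0"
  shows "((\<lambda>y. mode_sum j k x y) has_vector_derivative mode_sum j (Suc k) x y) (at y)"
proof -
  \<comment> \<open>No majorant is available down to y = 0, so the domain is cut at
    \<open>y / 2\<close>.\<close>
  obtain M where "M summable_on L"
    "\<And>i y'. i \<in> L \<Longrightarrow> y / 2 \<le> y' \<Longrightarrow> norm (mode j (Suc k) x y' i) \<le> M i"
    using mode_dominated[of "y / 2"] assms by (metis half_gt_zero)
  then show ?thesis
    unfolding mode_sum_def
    by (intro has_vector_derivative_infsum[where S = "{y / 2<..}"] has_vector_derivative_mode_y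
        summable_on_mode) (use assms in auto)
qed

text \<open>The sum over the lattice of \<open>energy_integral_identity\<close> times the phase; the
  two x-derivatives supply (2 pi i uv)^2 = -4 pi^2 u^2 v^2.\<close>

lemma mode_sum_identity:
  assumes "y > 0"
  shows "- (y * mode_sum 2 0 x y + mode_sum 0 1 x y + y * mode_sum 0 2 x y) =
    pi / 2 * ((\<Sum>\<^sub>\<infinity>i\<in>L. boundary r x y i) - (\<Sum>\<^sub>\<infinity>i\<in>L. boundary p x y i))"
proof (rule has_sum_unique)
  show "((\<lambda>i. - (y * mode 2 0 x y i + mode 0 1 x y i + y * mode 0 2 x y i)) has_sum
      - (y * mode_sum 2 0 x y + mode_sum 0 1 x y + y * mode_sum 0 2 x y)) L"
    unfolding mode_sum_def
    by (intro has_sum_uminusI has_sum_add has_sum_cmult_right has_sum_infsum summable_on_mode assms)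
  have "- (y * mode 2 0 x y i + mode 0 1 x y i + y * mode 0 2 x y i) =
      pi / 2 * (boundary r x y i - boundary p x y i)" for i
  proof -
    let ?I = "\<lambda>k. energy_integral k p r (u i) (v i) y"
    have "- (y * mode 2 0 x y i + mode 0 1 x y i + y * mode 0 2 x y i) =
        \<omega> i * exp (2 * pi * \<i> * x * (u i * v i)) *
        of_real (4 * pi\<^sup>2 * (u i)\<^sup>2 * (v i)\<^sup>2 * y * ?I 0 - ?I 1 - y * ?I 2)"
      by (simp add: mode_def power_mult_distrib algebra_simps)
    also have "\<dots> = pi / 2 * (boundary r x y i - boundary p x y i)"
      unfolding energy_integral_identity by (simp add: boundary_def algebra_simps diff_divide_distrib exp_of_real)
    finally show ?thesis .
  qed
  then show "((\<lambda>i. - (y * mode 2 0 x y i + mode 0 1 x y i + y * mode 0 2 x y i)) has_sum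
      pi / 2 * ((\<Sum>\<^sub>\<infinity>i\<in>L. boundary r x y i) - (\<Sum>\<^sub>\<infinity>i\<in>L. boundary p x y i))) L"
    by (simp only:) (intro has_sum_cmult_right has_sum_diff has_sum_infsum summable_on_boundary assms)
qed

text \<open>Two y-derivatives falling on y^(1/2) give -1/4 y^(-3/2), which the shift by 1/4 cancels
  exactly. What remains is y^(3/2) times the left-hand side of
  \<open>mode_sum_identity\<close>.\<close>

lemma Delta0_mode_sum:
  fixes \<tau> :: complex
  defines "\<Phi> \<equiv> \<lambda>z. of_real (Im z powr (1/2)) * mode_sum 0 0 (Re z) (Im z)"
  assumes \<tau>: "Im \<tau> > 0"
  shows "Delta0_defined \<Phi> \<tau>"
    "Delta0 \<Phi> \<tau> - 1/4 * \<Phi> \<tau> = pi / 2 * (of_real (Im \<tau> powr (3/2)) *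
       ((\<Sum>\<^sub>\<infinity>i\<in>L. boundary r (Re \<tau>) (Im \<tau>) i) - (\<Sum>\<^sub>\<infinity>i\<in>L. boundary p (Re \<tau>) (Im \<tau>) i)))"
proof -
  let ?T = "mode_sum"
  define x y where "x = Re \<tau>" and "y = Im \<tau>"
  have y: "y > 0" using \<tau> by (simp add: y_def)
  have dx: "((\<lambda>x. of_real (y powr (1/2)) * ?T j 0 x y) has_vector_derivative
      of_real (y powr (1/2)) * ?T (Suc j) 0 x y) (at x)" for j x
    by (intro has_vector_derivative_mult_right has_vector_derivative_mode_sum_x y)
  \<comment> \<open>The exponent is kept general because the second derivative also needs it at
    -1/2.\<close>
  have dy: "((\<lambda>y. of_real (y powr e) * ?T 0 k x y) has_vector_derivative
      of_real (y powr e) * ?T 0 (Suc k) x y + of_real (e * y powr (e - 1)) * ?T 0 k x y) (at y)"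
    if "y > 0" for e k x y
    by (intro has_vector_derivative_mult has_vector_derivative_of_real has_real_derivative_powr
        has_vector_derivative_mode_sum_y that)
  have px: "partial_x \<Phi> (Complex x' y) = of_real (y powr (1/2)) * ?T 1 0 x' y" for x'
    unfolding partial_x_def \<Phi>_def using dx[of 0] by (simp add: vector_derivative_at)
  have py: "partial_y \<Phi> (Complex x y') = of_real (y' powr (1/2)) * ?T 0 1 x y' +
      of_real (1/2) * (of_real (y' powr (- 1/2)) * ?T 0 0 x y')" if "y' > 0" for y'
    unfolding partial_y_def \<Phi>_def using vector_derivative_at[OF dy[OF that, of "1/2" 0]] by simp
  have dpx: "((\<lambda>x'. partial_x \<Phi> (Complex x' y)) has_vector_derivative
      of_real (y powr (1/2)) * ?T 2 0 x y) (at x)"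
    unfolding px using dx[of 1 x] by (simp add: numeral_2_eq_2)
  let ?D = "(of_real (y powr (1/2)) * ?T 0 2 x y + of_real (1/2 * y powr (- 1/2)) * ?T 0 1 x y) +
      of_real (1/2) * (of_real (y powr (- 1/2)) * ?T 0 1 x y
        + of_real (- 1/2 * y powr (- 3/2)) * ?T 0 0 x y)"
  have "((\<lambda>y. of_real (y powr (1/2)) * ?T 0 1 x y + of_real (1/2) * (of_real (y powr (- 1/2)) * ?T 0 0 x y))
      has_vector_derivative ?D) (at y)"
    using has_vector_derivative_add[OF dy[OF y, of "1/2" 1]
        has_vector_derivative_mult_right[OF dy[OF y, of "-1/2" 0], of "of_real (1/2)"]]
    by (simp add: numeral_2_eq_2)
  then have dpy: "((\<lambda>y'. partial_y \<Phi> (Complex x y')) has_vector_derivative ?D) (at y)"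
    \<comment> \<open>The formula \<open>py\<close> holds only for positive arguments, hence the
      restriction to the open half-line.\<close>
    by (rule has_vector_derivative_transform_within_open[where S = "{0<..}"]) (use y py in auto)
  show "Delta0_defined \<Phi> \<tau>"
    unfolding Delta0_defined_def x_def[symmetric] y_def[symmetric]
  proof (intro conjI)
    show "(\<lambda>x. \<Phi> (Complex x y)) differentiable at x"
      unfolding \<Phi>_def complex.sel using dx by (rule differentiableI_vector)
    show "(\<lambda>y. \<Phi> (Complex x y)) differentiable at y"
      unfolding \<Phi>_def complex.sel using dy[OF y] by (rule differentiableI_vector)
  qed (use dpx dpy in \<open>blast intro: differentiableI_vector\<close>)+
  have Delta0: "Delta0 \<Phi> \<tau> = - of_real (y\<^sup>2) * (of_real (y powr (1/2)) * ?T 2 0 x y + ?D)"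
    unfolding Delta0_def partial_x_def[of "partial_x \<Phi>"] partial_y_def[of "partial_y \<Phi>"]
      x_def[symmetric] y_def[symmetric]
    using vector_derivative_at[OF dpx] vector_derivative_at[OF dpy] by simp
  have \<Phi>: "\<Phi> \<tau> = of_real (y powr (1/2)) * ?T 0 0 x y"
    by (simp add: \<Phi>_def x_def y_def)
  \<comment> \<open>All powers become rational multiples of y^(1/2), so that the next claim is a
    field identity with \<open>s\<close> in its place.\<close>
  have powr: "y powr (- 1/2) = y powr (1/2) / y" "y powr (- 3/2) = y powr (1/2) / y\<^sup>2"
      "y powr (3/2) = y * y powr (1/2)"
    using y powr_diff[of y "1/2" 1] powr_diff[of y "1/2" 2] powr_add[of y 1 "1/2"] by simp_all
  have "- of_real (y\<^sup>2) * (of_real s * c + ((of_real s * d + of_real (1/2 * (s / y)) * b) +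
        of_real (1/2) * (of_real (s / y) * b + of_real (- 1/2 * (s / y\<^sup>2)) * a))) - 1/4 * (of_real s * a) =
      of_real (y * s) * (- (y * c + b + y * d))" for s and a b c d :: complex
    using y by (simp add: field_simps power2_eq_square)
  then have "Delta0 \<Phi> \<tau> - 1/4 * \<Phi> \<tau> = of_real (y powr (3/2)) *
      (- (y * ?T 2 0 x y + ?T 0 1 x y + y * ?T 0 2 x y))"
    unfolding Delta0 \<Phi> powr .
  also have "\<dots> = pi / 2 * (of_real (y powr (3/2)) *
       ((\<Sum>\<^sub>\<infinity>i\<in>L. boundary r x y i) - (\<Sum>\<^sub>\<infinity>i\<in>L. boundary p x y i)))"
    unfolding mode_sum_identity[OF y] by simp
  finally show "Delta0 \<Phi> \<tau> - 1/4 * \<Phi> \<tau> = pi / 2 * (of_real (Im \<tau> powr (3/2)) *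
       ((\<Sum>\<^sub>\<infinity>i\<in>L. boundary r (Re \<tau>) (Im \<tau>) i) - (\<Sum>\<^sub>\<infinity>i\<in>L. boundary p (Re \<tau>) (Im \<tau>) i)))"
    by (simp add: x_def y_def)
qed

end

subsection \<open>Hyperbolic coordinates\<close>

lemma B_form_hyperbolic:
  fixes P :: "real^2^2"
  assumes "A = transpose P ** hyp_matrix ** P"
  shows "B_form A \<nu> \<mu> = (P *v \<nu>) $ 1 * (P *v \<mu>) $ 2 + (P *v \<nu>) $ 2 * (P *v \<mu>) $ 1"
  by (simp add: assms B_form_def hyp_matrix_def inner_vec_def sum_2 matrix_vector_mult_def
      matrix_matrix_mult_def transpose_def algebra_simps)

lemma Q_form_hyperbolic:
  fixes P :: "real^2^2"
  assumes "A = transpose P ** hyp_matrix ** P"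
  shows "Q_form A \<nu> = (P *v \<nu>) $ 1 * (P *v \<nu>) $ 2"
  using B_form_hyperbolic[OF assms, of \<nu> \<nu>] by (simp add: Q_form_def B_form_def)

lemma matrix_mult_c_curve:
  assumes "invertible P"
  shows "P *v c_curve P t = vector [exp t, - exp (- t)]" "P *v c_perp P t = vector [exp t, exp (- t)]"
  using assms by (simp_all add: c_curve_def c_perp_def matrix_vector_mul_assoc matrix_inv_mult)

text \<open>Along a component of \<open>Q = - 1\<close> the product of the two coordinates of \<open>P *v c\<close> is \<open>- 1\<close>, so by
  connectedness the first one keeps the sign it has at the base point, and \<open>t\<close> is its logarithm.\<close>

lemma c_curve_t_param:
  fixes P :: "real^2^2"
  assumes P: "invertible P" and A: "A = transpose P ** hyp_matrix ** P"
    and C: "C \<in> components {c. Q_form A c = -1}"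
    and base: "matrix_inv P *v vector [1, -1] \<in> C" and c: "c \<in> C"
  shows "c_curve P (t_param P c) = c"
proof -
  let ?f = "\<lambda>c. (P *v c) $ 1"
  have Q: "?f c * (P *v c) $ 2 = - 1" if "c \<in> C" for c
    using in_components_subset[OF C] that Q_form_hyperbolic[OF A] by auto
  have "connected (?f ` C)"
    by (intro connected_continuous_image continuous_intros in_components_connected[OF C]
        linear_continuous_on bounded_linear_compose[OF bounded_linear_vec_nth] 
        matrix_vector_mul_bounded_linear)
  moreover have "1 \<in> ?f ` C"
    using base P by (force simp: matrix_vector_mul_assoc matrix_inv_mult)
  moreover have "0 \<notin> ?f ` C" using Q by force
  ultimately have pos: "?f c > 0"
    using c connectedD_interval[of "?f ` C" "?f c" 1 0] by force
  have "P *v c_curve P (ln (?f c)) = P *v c"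
    unfolding matrix_mult_c_curve[OF P]
    using pos Q[OF c] by (simp add: vec_eq_iff forall_2 exp_minus field_simps)
  moreover have inj: "\<mu> = \<nu>" if "P *v \<mu> = P *v \<nu>" for \<mu> \<nu>
    using arg_cong[OF that, of "\<lambda>w. matrix_inv P *v w"] P
    by (simp add: matrix_vector_mul_assoc matrix_inv_mult)
  ultimately have "c_curve P (ln (?f c)) = c" by blast
  \<comment> \<open>Uniqueness, required by the definite description in
    \<open>t_param\<close>.\<close>
  moreover have "t = ln (?f c)" if "c_curve P t = c" for t
    using matrix_mult_c_curve(1)[OF P, of t] that by simp
  ultimately show ?thesis
    unfolding t_param_def by (rule theI)
qed

text \<open>Summability and \<open>Delta0_defined\<close> are part of the claim because
  \<open>infsum\<close> and \<open>vector_derivative\<close> take default or unspecified values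
  otherwise.\<close>

theorem theorem3:
  fixes A P :: "real^2^2" and C :: "(real^2) set" and c1 c2 a b :: "real^2"
  assumes "transpose A = A"
    and "\<forall>i j. A $ i $ j \<in> \<int>"
    and "has_signature (Q_form A) 1 1"
    and "C \<in> components {c. Q_form A c = -1}"
    and "invertible P"
    and "A = transpose P ** hyp_matrix ** P"
    and "matrix_inv P *v vector [1, -1] \<in> C"
    and "c1 \<in> C" and "c2 \<in> C"
  shows "\<forall>\<tau>. Im \<tau> > 0 \<longrightarrow>
    Phi_term A P c1 c2 b \<tau> summable_on shifted_lattice a \<and>
    theta_term A P c1 b \<tau> summable_on shifted_lattice a \<and>
    theta_term A P c2 b \<tau> summable_on shifted_lattice a \<and>
    Delta0_defined (Phi_hat A P c1 c2 a b) \<tau> \<and>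
    Delta0 (Phi_hat A P c1 c2 a b) \<tau> - 1/4 * Phi_hat A P c1 c2 a b \<tau> =
      pi / 2 * (theta A P c2 a b \<tau> - theta A P c1 a b \<tau>)"
proof (intro allI impI)
  fix \<tau> :: complex assume \<tau>: "Im \<tau> > 0"
  define u v where "u \<nu> = (P *v \<nu>) $ 1" and "v \<nu> = (P *v \<nu>) $ 2" for \<nu>
  define \<omega> where "\<omega> \<nu> = exp (2 * pi * \<i> * of_real (B_form A \<nu> b))" for \<nu>
  interpret gaussian_family "shifted_lattice a" u v \<omega> "t_param P c1" "t_param P c2"
  proof
    show "(\<lambda>\<nu>. exp (- (c * ((u \<nu>)\<^sup>2 + (v \<nu>)\<^sup>2)))) summable_on shifted_lattice a" if "c > 0" for c
      unfolding u_def v_def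
      by (rule summable_on_shifted_lattice_gaussian_invertible[OF assms(5) that])
  qed (simp add: \<omega>_def norm_exp_eq_Re)
  have Q: "Q_form A \<nu> = u \<nu> * v \<nu>" for \<nu>
    by (simp add: Q_form_hyperbolic[OF assms(6)] u_def v_def)
  have B: "B_form A \<nu> (c_curve P t) = v \<nu> * exp t - u \<nu> * exp (- t)"
      "B_form A \<nu> (c_perp P t) = v \<nu> * exp t + u \<nu> * exp (- t)" for \<nu> t
    by (simp_all add: B_form_hyperbolic[OF assms(6)] matrix_mult_c_curve[OF assms(5)] u_def v_def)
  \<comment> \<open>Makes the three identities below polynomial in exp(t) and exp(-t).\<close>
  have exp2: "exp (2 * t) = (exp t)\<^sup>2" "exp (- 2 * t) = (exp (- t))\<^sup>2" "exp t * exp (- t) = 1" for t :: real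
    by (simp_all add: power2_eq_square flip: exp_add)
  have B_squared: "(B_form A \<nu> (c_curve P t))\<^sup>2 = energy (u \<nu>) (v \<nu>) t - 2 * (u \<nu> * v \<nu>)" for \<nu> t
    using exp2(3)[of t] unfolding B energy_def exp2(1,2) by algebra
  have B_perp_squared: "(B_form A \<nu> (c_perp P t))\<^sup>2 = energy (u \<nu>) (v \<nu>) t + 2 * (u \<nu> * v \<nu>)" for \<nu> t
    using exp2(3)[of t] unfolding B energy_def exp2(1,2) by algebra
  have B_prod: "B_form A \<nu> (c_curve P t) * B_form A \<nu> (c_perp P t) = flux (u \<nu>) (v \<nu>) t" for \<nu> t
    unfolding B flux_def exp2(1,2) by algebra
  have Phi_term: "Phi_term A P c1 c2 b z = mode 0 0 (Re z) (Im z)" for z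
  proof
    fix \<nu>
    let ?e = "\<lambda>t. exp (- pi * Im z * energy (u \<nu>) (v \<nu>) t)"
    have "exp (2 * pi * \<i> * z * of_real (u \<nu> * v \<nu>)) =
        exp (2 * pi * \<i> * Re z * (u \<nu> * v \<nu>)) * of_real (exp (- 2 * pi * Im z * (u \<nu> * v \<nu>)))"
      unfolding exp_of_real[symmetric] exp_add[symmetric]
      by (rule arg_cong[where f = exp], subst (1) complex_eq[of z]) (simp add: algebra_simps)
    \<comment> \<open>The real factor of q^Q moves under the integral and cancels the -2uv in
      \<open>B_squared\<close>, leaving the energy alone.\<close>
    moreover have "exp (- 2 * pi * Im z * (u \<nu> * v \<nu>)) *
        (LBINT t=t_param P c1..t_param P c2. exp (- pi * Im z * (B_form A \<nu> (c_curve P t))\<^sup>2)) =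
        (LBINT t=t_param P c1..t_param P c2. ?e t)"
      unfolding interval_lebesgue_integral_mult_right[symmetric] exp_add[symmetric] B_squared
      by (simp add: algebra_simps)
    ultimately show "Phi_term A P c1 c2 b z \<nu> = mode 0 0 (Re z) (Im z) \<nu>"
      unfolding Phi_term_def mode_def energy_integral_def Q \<omega>_def[symmetric]
      by (simp flip: of_real_mult)
  qed
  have theta_term: "theta_term A P c b \<tau> = boundary (t_param P c) (Re \<tau>) (Im \<tau>)" if "c \<in> C" for c
  proof
    fix \<nu>
    let ?t = "t_param P c"
    have c: "B_form A \<nu> c = B_form A \<nu> (c_curve P ?t)"
      using c_curve_t_param[OF assms(5,6,4,7) that] by simp
    \<comment> \<open>The energy meets tau - cnj tau = 2iy, while 2uv meets tau + cnj tau =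
      2x.\<close>
    have "pi * \<i> / 2 * \<tau> * of_real ((B_form A \<nu> (c_perp P ?t))\<^sup>2)
          - pi * \<i> / 2 * cnj \<tau> * of_real ((B_form A \<nu> (c_curve P ?t))\<^sup>2) =
        2 * pi * \<i> * Re \<tau> * (u \<nu> * v \<nu>) + of_real (- pi * Im \<tau> * energy (u \<nu>) (v \<nu>) ?t)"
      unfolding B_squared B_perp_squared by (simp add: complex_eq_iff field_simps)
    then have exponent: "exp (pi * \<i> / 2 * \<tau> * of_real ((B_form A \<nu> (c_perp P ?t))\<^sup>2)
          - pi * \<i> / 2 * cnj \<tau> * of_real ((B_form A \<nu> (c_curve P ?t))\<^sup>2)) =
        exp (2 * pi * \<i> * Re \<tau> * (u \<nu> * v \<nu>)) * of_real (exp (- pi * Im \<tau> * energy (u \<nu>) (v \<nu>) ?t))"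
      by (simp only: exp_add exp_of_real)
    show "theta_term A P c b \<tau> \<nu> = boundary ?t (Re \<tau>) (Im \<tau>) \<nu>"
      unfolding theta_term_def Let_def c exponent B_prod boundary_def \<omega>_def[symmetric]
      by (simp add: mult_ac)
  qed
  \<comment> \<open>An equality of functions rather than of values at \<open>\<tau>\<close>, because
    \<open>Delta0\<close> differentiates.\<close>
  have Phi_hat: "Phi_hat A P c1 c2 a b = (\<lambda>z. of_real (Im z powr (1/2)) * mode_sum 0 0 (Re z) (Im z))"
    by (simp add: fun_eq_iff Phi_hat_def Phi_term mode_sum_def)
  show "Phi_term A P c1 c2 b \<tau> summable_on shifted_lattice a \<and>
    theta_term A P c1 b \<tau> summable_on shifted_lattice a \<and>
    theta_term A P c2 b \<tau> summable_on shifted_lattice a \<and>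
    Delta0_defined (Phi_hat A P c1 c2 a b) \<tau> \<and>
    Delta0 (Phi_hat A P c1 c2 a b) \<tau> - 1/4 * Phi_hat A P c1 c2 a b \<tau> =
      pi / 2 * (theta A P c2 a b \<tau> - theta A P c1 a b \<tau>)"
    unfolding Phi_term theta_def theta_term[OF assms(8)] theta_term[OF assms(9)] Phi_hat
      right_diff_distrib[symmetric, where a = "of_real (Im \<tau> powr (3/2))"]
    by (intro conjI summable_on_mode summable_on_boundary Delta0_mode_sum \<tau>)
qed

end
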